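(* Let $k$ be a field, $\mathfrak{g}$ a nonzero Lie algebra over $k$, $E$ a vector space that contains $\mathfrak{g}$ as a subspace and $V$ a complement of $\mathfrak{g}$ in $E$. Then: (1) The relation $\equiv$ is an equivalence relation on the set $\mathcal{L}(\mathfrak{g}, V)$ of all Lie extending structures of $\mathfrak{g}$ through $V$. Denote by $\mathcal{H}^{2}_{\mathfrak{g}}(V, \mathfrak{g}) := \mathcal{L}(\mathfrak{g}, V)/\equiv$ the pointed quotient set. (2) The map $$\mathcal{H}^{2}_{\mathfrak{g}}(V, \mathfrak{g}) \to \mathrm{Extd}(E, \mathfrak{g}), \qquad \overline{(\triangleleft, \triangleright, f, \{-,-\})} \mapsto \bigl(\mathfrak{g} \,\natural\, V, [-,-]\bigr)$$ is bijective, where $\overline{(\triangleleft, \triangleright, f, \{-,-\})}$ is the equivalence class of $(\triangleleft, \triangleright, f, \{-,-\})$ via $\equiv$.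
   Context: All vector spaces, Lie algebras, linear and bilinear maps are over an arbitrary field $k$. A complement of $\mathfrak{g}$ in $E$ is a subspace $V$ with $E=\mathfrak{g}+V$ and $V\cap\mathfrak{g}=0$. Unified products. An extending datum of $\mathfrak{g}$ through $V$ is a system $\Omega(\mathfrak{g}, V) = (\triangleleft, \triangleright, f, \{-,-\})$ of four bilinear maps $\triangleleft : V \times \mathfrak{g} \to V$, $\triangleright : V \times \mathfrak{g} \to \mathfrak{g}$, $f : V\times V \to \mathfrak{g}$, $\{-,-\} : V\times V \to V$. It is a Lie extending structure if $\mathfrak{g}\times V$ is a Lie algebra with the bracket $$[(g, x), (h, y)] := \bigl([g, h] + x \triangleright h - y\triangleright g + f(x, y),\ \{x, y\} + x\triangleleft h - y\triangleleft g\bigr);$$ this Lie algebra is denoted $\mathfrak{g}\,\natural\, V$ (the unified product). $\mathcal{L}(\mathfrak{g},V)$ is the set of all Lie extending structures, pointed by the trivial one (all four maps zero). The relation $\equiv$ on $\mathcal{L}(\mathfrak{g},V)$. $(\triangleleft, \triangleright, f, \{-,-\})\equiv(\triangleleft', \triangleright', f', \{-,-\}')$ if there exist a linear map $r: V\to\mathfrak{g}$ and $v\in\mathrm{Aut}_k(V)$ (linear automorphism) such that for all $g\in\mathfrak{g}$, $x,y\in V$: \begin{align*} x \triangleleft' g &= v\bigl(v^{-1}(x) \triangleleft g\bigr),\\ x \triangleright' g &= r\bigl(v^{-1}(x) \triangleleft g\bigr) + v^{-1}(x) \triangleright g + [g, r(v^{-1}(x))],\\ f'(x, y) &= f\bigl(v^{-1}(x),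 v^{-1}(y)\bigr) + r\bigl(\{v^{-1}(x), v^{-1}(y)\}\bigr) + [r(v^{-1}(x)), r(v^{-1}(y))]\\ &\quad - r\bigl(v^{-1}(x) \triangleleft r(v^{-1}(y))\bigr) - v^{-1}(x) \triangleright r(v^{-1}(y))\\ &\quad + r\bigl(v^{-1}(y) \triangleleft r(v^{-1}(x))\bigr) + v^{-1}(y) \triangleright r(v^{-1}(x)),\\ \{x, y\}' &= v\bigl(\{v^{-1}(x), v^{-1}(y)\}\bigr) - v\bigl(v^{-1}(x) \triangleleft r(v^{-1}(y))\bigr) + v\bigl(v^{-1}(y) \triangleleft r(v^{-1}(x))\bigr). \end{align*} The set $\mathrm{Extd}(E,\mathfrak{g})$. Two Lie algebra structures on $E$, both containing $\mathfrak{g}$ as a Lie subalgebra, are equivalent if there is a Lie algebra isomorphism $\varphi$ from $E$ with the first structure to $E$ with the second that stabilizes $\mathfrak{g}$, i.e. $\varphi(g)=g$ for all $g\in\mathfrak{g}$. $\mathrm{Extd}(E,\mathfrak{g})$ is the set of equivalence classes. In (2), $(\mathfrak{g}\,\natural\, V,[-,-])$ denotes the class of the Lie algebra structure on $E$ obtained by transporting the bracket of $\mathfrak{g}\,\natural\, V$ along the linear isomorphism $\mathfrak{g}\times V\to E$, $(g,x)\mapsto g+x$. *)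

theory Defs
  imports "HOL-Analysis.Product_Vector" "HOL-Library.FuncSet"
begin

text \<open>
  Throughout, the vector space \<open>E\<close> is a type \<open>'e\<close> with scalar multiplication \<open>sc\<close>, and
  \<open>\<gg>\<close> (written \<open>G\<close>, with bracket \<open>br\<close>) and \<open>V\<close> are subspaces of it, given as sets.
\<close>

definition linear_on ::
  "('k::field \<Rightarrow> 'e::ab_group_add \<Rightarrow> 'e) \<Rightarrow> 'e set \<Rightarrow> 'e set \<Rightarrow> ('e \<Rightarrow> 'e) \<Rightarrow> bool" where
  "linear_on sc S T f \<longleftrightarrow> f \<in> S \<rightarrow> T \<and>
     (\<forall>x\<in>S. \<forall>y\<in>S. f (x + y) = f x + f y) \<and>
     (\<forall>c. \<forall>x\<in>S. f (sc c x) = sc c (f x))"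

definition bilinear_on ::
  "('k::field \<Rightarrow> 'e::ab_group_add \<Rightarrow> 'e) \<Rightarrow> 'e set \<Rightarrow> 'e set \<Rightarrow> 'e set \<Rightarrow> ('e \<Rightarrow> 'e \<Rightarrow> 'e) \<Rightarrow> bool" where
  "bilinear_on sc S T U b \<longleftrightarrow>
     (\<forall>x\<in>S. linear_on sc T U (b x)) \<and> (\<forall>y\<in>T. linear_on sc S U (\<lambda>x. b x y))"

locale lie_algebra = vector_space sc
  for sc :: "'k::field \<Rightarrow> 'e::ab_group_add \<Rightarrow> 'e" +
  fixes L :: "'e set" and br :: "'e \<Rightarrow> 'e \<Rightarrow> 'e"
  assumes subspace_carrier: "subspace L"
    and bilinear_br: "bilinear_on sc L L L br"
    and alternating: "x \<in> L \<Longrightarrow> br x x = 0"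
    and jacobi: "\<lbrakk>x \<in> L; y \<in> L; z \<in> L\<rbrakk> \<Longrightarrow>
      br x (br y z) + br y (br z x) + br z (br x y) = 0"

definition is_complement ::
  "('k::field \<Rightarrow> 'e::ab_group_add \<Rightarrow> 'e) \<Rightarrow> 'e set \<Rightarrow> 'e set \<Rightarrow> bool" where
  "is_complement sc G V \<longleftrightarrow> module.subspace sc V \<and>
     {g + x |g x. g \<in> G \<and> x \<in> V} = UNIV \<and> V \<inter> G = {0}"

text \<open>
  The four maps of an extending datum are, in order, \<open>x \<triangleleft> g\<close>, \<open>x \<triangleright> g\<close>, \<open>f x y\<close> and \<open>{x, y}\<close>.
\<close>

record 'e extending_datum =
  ract :: "'e \<Rightarrow> 'e \<Rightarrow> 'e"
  lact :: "'e \<Rightarrow> 'e \<Rightarrow> 'e"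
  cocycle :: "'e \<Rightarrow> 'e \<Rightarrow> 'e"
  vbr :: "'e \<Rightarrow> 'e \<Rightarrow> 'e"

text \<open>
  Extensional function spaces are used so that two data are equal as soon as their maps
  agree on \<open>V \<times> \<gg>\<close> and \<open>V \<times> V\<close>.
\<close>

definition extending_data ::
  "('k::field \<Rightarrow> 'e::ab_group_add \<Rightarrow> 'e) \<Rightarrow> 'e set \<Rightarrow> 'e set \<Rightarrow> 'e extending_datum set" where
  "extending_data sc G V = {\<Omega>.
     ract \<Omega> \<in> V \<rightarrow>\<^sub>E G \<rightarrow>\<^sub>E V \<and> bilinear_on sc V G V (ract \<Omega>) \<and>
     lact \<Omega> \<in> V \<rightarrow>\<^sub>E G \<rightarrow>\<^sub>E G \<and> bilinear_on sc V G G (lact \<Omega>) \<and>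
     cocycle \<Omega> \<in> V \<rightarrow>\<^sub>E V \<rightarrow>\<^sub>E G \<and> bilinear_on sc V V G (cocycle \<Omega>) \<and>
     vbr \<Omega> \<in> V \<rightarrow>\<^sub>E V \<rightarrow>\<^sub>E V \<and> bilinear_on sc V V V (vbr \<Omega>)}"

fun unified_br ::
  "('e::ab_group_add \<Rightarrow> 'e \<Rightarrow> 'e) \<Rightarrow> 'e extending_datum \<Rightarrow> 'e \<times> 'e \<Rightarrow> 'e \<times> 'e \<Rightarrow> 'e \<times> 'e" where
  "unified_br br \<Omega> (g, x) (h, y) =
     (br g h + lact \<Omega> x h - lact \<Omega> y g + cocycle \<Omega> x y,
      vbr \<Omega> x y + ract \<Omega> x h - ract \<Omega> y g)"

definition lie_extending_structures ::
  "('k::field \<Rightarrow> 'e::ab_group_add \<Rightarrow> 'e) \<Rightarrow> 'e set \<Rightarrow> ('e \<Rightarrow> 'e \<Rightarrow> 'e) \<Rightarrow> 'e set \<Rightarrow> 'e extending_datum set" where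
  "lie_extending_structures sc G br V = {\<Omega> \<in> extending_data sc G V.
     lie_algebra (module_prod.scale sc sc) (G \<times> V) (unified_br br \<Omega>)}"

definition trivial_structure :: "'e::ab_group_add set \<Rightarrow> 'e set \<Rightarrow> 'e extending_datum" where
  "trivial_structure G V =
     \<lparr>ract = (\<lambda>x\<in>V. \<lambda>g\<in>G. 0), lact = (\<lambda>x\<in>V. \<lambda>g\<in>G. 0),
      cocycle = (\<lambda>x\<in>V. \<lambda>y\<in>V. 0), vbr = (\<lambda>x\<in>V. \<lambda>y\<in>V. 0)\<rparr>"

definition ext_equiv ::
  "('k::field \<Rightarrow> 'e::ab_group_add \<Rightarrow> 'e) \<Rightarrow> 'e set \<Rightarrow> ('e \<Rightarrow> 'e \<Rightarrow> 'e) \<Rightarrow> 'e set \<Rightarrow> 'e extending_datum rel" where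
  "ext_equiv sc G br V =
     {(\<Omega>, \<Omega>'). \<Omega> \<in> lie_extending_structures sc G br V \<and>
        \<Omega>' \<in> lie_extending_structures sc G br V \<and>
        (\<exists>r v. linear_on sc V G r \<and> linear_on sc V V v \<and> bij_betw v V V \<and>
          (let w = inv_into V v in
           \<forall>g\<in>G. \<forall>x\<in>V. \<forall>y\<in>V.
             ract \<Omega>' x g = v (ract \<Omega> (w x) g) \<and>
             lact \<Omega>' x g = r (ract \<Omega> (w x) g) + lact \<Omega> (w x) g + br g (r (w x)) \<and>
             cocycle \<Omega>' x y =
               cocycle \<Omega> (w x) (w y) + r (vbr \<Omega> (w x) (w y)) + br (r (w x)) (r (w y))
               - r (ract \<Omega> (w x) (r (w y))) - lact \<Omega> (w x) (r (w y))
               + r (ract \<Omega> (w y) (r (w x))) + lact \<Omega> (w y) (r (w x)) \<and>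
             vbr \<Omega>' x y =
               v (vbr \<Omega> (w x) (w y)) - v (ract \<Omega> (w x) (r (w y)))
               + v (ract \<Omega> (w y) (r (w x)))))}"

definition H2 ::
  "('k::field \<Rightarrow> 'e::ab_group_add \<Rightarrow> 'e) \<Rightarrow> 'e set \<Rightarrow> ('e \<Rightarrow> 'e \<Rightarrow> 'e) \<Rightarrow> 'e set \<Rightarrow> 'e extending_datum set set" where
  "H2 sc G br V = lie_extending_structures sc G br V // ext_equiv sc G br V"

definition lie_structures ::
  "('k::field \<Rightarrow> 'e::ab_group_add \<Rightarrow> 'e) \<Rightarrow> 'e set \<Rightarrow> ('e \<Rightarrow> 'e \<Rightarrow> 'e) \<Rightarrow> ('e \<Rightarrow> 'e \<Rightarrow> 'e) set" where
  "lie_structures sc G br =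
     {B. lie_algebra sc UNIV B \<and> (\<forall>g\<in>G. \<forall>h\<in>G. B g h = br g h)}"

definition stab_equiv ::
  "('k::field \<Rightarrow> 'e::ab_group_add \<Rightarrow> 'e) \<Rightarrow> 'e set \<Rightarrow> ('e \<Rightarrow> 'e \<Rightarrow> 'e) \<Rightarrow> ('e \<Rightarrow> 'e \<Rightarrow> 'e) rel" where
  "stab_equiv sc G br =
     {(B, B'). B \<in> lie_structures sc G br \<and> B' \<in> lie_structures sc G br \<and>
        (\<exists>\<phi>. Vector_Spaces.linear sc sc \<phi> \<and> bij \<phi> \<and>
          (\<forall>a b. \<phi> (B a b) = B' (\<phi> a) (\<phi> b)) \<and> (\<forall>g\<in>G. \<phi> g = g))}"

definition Extd ::
  "('k::field \<Rightarrow> 'e::ab_group_add \<Rightarrow> 'e) \<Rightarrow> 'e set \<Rightarrow> ('e \<Rightarrow> 'e \<Rightarrow> 'e) \<Rightarrow> ('e \<Rightarrow> 'e \<Rightarrow> 'e) set set" where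
  "Extd sc G br = lie_structures sc G br // stab_equiv sc G br"

text \<open>The bracket of \<open>\<gg> \<natural> V\<close> transported to \<open>E\<close> along \<open>(g, x) \<mapsto> g + x\<close>.\<close>

definition transported_br ::
  "'e::ab_group_add set \<Rightarrow> ('e \<Rightarrow> 'e \<Rightarrow> 'e) \<Rightarrow> 'e set \<Rightarrow> 'e extending_datum \<Rightarrow> 'e \<Rightarrow> 'e \<Rightarrow> 'e" where
  "transported_br G br V \<Omega> a b =
     (let \<theta> = (\<lambda>(g, x). g + x); \<theta>' = inv_into (G \<times> V) \<theta>
      in \<theta> (unified_br br \<Omega> (\<theta>' a) (\<theta>' b)))"

end

theory Submission
  imports Defs
begin

text \<open>
  Everything follows from one observation: \<open>E = \<gg> \<oplus> V\<close>, so a bracket on \<open>E\<close> that extends the one of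
  \<open>\<gg>\<close> carries the same information as its components on \<open>V \<times> \<gg>\<close> and \<open>V \<times> V\<close>. These components are
  the four maps of an extending datum, and the unified product formula is the expansion of
  \<open>[g + x, h + y]\<close> by bilinearity and antisymmetry. Hence transporting the bracket of \<open>\<gg> \<natural> V\<close> to
  \<open>E\<close> maps the Lie extending structures onto the Lie structures on \<open>E\<close> that contain \<open>\<gg>\<close>
  (\<open>brE_lie_structure\<close>, \<open>datum_of_mem\<close>). The Lie algebra axioms pass between \<open>\<gg> \<times> V\<close> and \<open>E\<close>
  without computation: they pull back along an injective linear map that respects the brackets
  (\<open>lie_algebra_pullback\<close>).

  The transport also matches the two relations. A linear automorphism of \<open>E\<close> that fixes \<open>\<gg>\<close>
  pointwise is determined by its restriction to \<open>V\<close>, that is, by a linear \<open>r : V \<rightarrow> \<gg>\<close> and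
  a linear automorphism \<open>v\<close> of \<open>V\<close>: it sends \<open>g + x\<close> to \<open>g + r x + v x\<close>
  (\<open>stabilizing_map_eq_stab_map\<close>). It respects two transported brackets exactly when the four
  formulas defining \<open>\<equiv>\<close> hold (\<open>stab_map_hom_iff\<close>). So \<open>\<equiv>\<close> is the
  pullback of the relation on Lie structures, which is an equivalence because the stabilizing
  isomorphisms form a groupoid. Therefore \<open>\<equiv>\<close> is an equivalence as well, and the transport
  induces a bijection of the quotients (\<open>equiv_pullback\<close>, \<open>bij_betw_quotients\<close>).
\<close>

section \<open>Pullbacks of equivalence relations\<close>

lemma equiv_pullback:
  assumes R: "equiv S R" and T: "T ` L \<subseteq> S"
    and Q: "\<And>a b. (a, b) \<in> Q \<longleftrightarrow> a \<in> L \<and> b \<in> L \<and> (T a, T b) \<in> R"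
  shows "equiv L Q"
proof (rule equivI)
  show "Q \<subseteq> L \<times> L" using Q by auto
  show "refl_on L Q" using R T Q by (auto simp: equiv_def refl_on_def)
  show "sym Q" using R Q by (auto simp: equiv_def sym_def)
  show "trans Q" using R Q by (auto simp: equiv_def trans_def; blast)
qed

text \<open>
  The bijection is \<open>C \<mapsto> R `` (T ` C)\<close>. It is one-to-one because \<open>Q\<close> relates all elements whose
  images are related, and onto because \<open>T\<close> is.
\<close>
lemma bij_betw_quotients:
  assumes R: "equiv S R" and T: "T ` L = S"
    and Q: "\<And>a b. (a, b) \<in> Q \<longleftrightarrow> a \<in> L \<and> b \<in> L \<and> (T a, T b) \<in> R"
  shows "\<exists>\<Phi>. (\<forall>a\<in>L. \<Phi> (Q `` {a}) = R `` {T a}) \<and> bij_betw \<Phi> (L // Q) (S // R)"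
proof -
  have equivQ: "equiv L Q"
    by (rule equiv_pullback[OF R _ Q]) (use T in auto)
  define \<Phi> where "\<Phi> C = R `` (T ` C)" for C
  have \<Phi>: "\<Phi> (Q `` {a}) = R `` {T a}" if a: "a \<in> L" for a
  proof
    show "\<Phi> (Q `` {a}) \<subseteq> R `` {T a}"
      using R by (auto simp: \<Phi>_def Q equiv_def trans_def)
    have "T a \<in> T ` (Q `` {a})"
      using equiv_class_self[OF equivQ a] by blast
    then show "R `` {T a} \<subseteq> \<Phi> (Q `` {a})"
      by (auto simp: \<Phi>_def)
  qed
  have "inj_on \<Phi> (L // Q)"
  proof (rule inj_onI)
    fix C D assume "C \<in> L // Q" "D \<in> L // Q" and eq: "\<Phi> C = \<Phi> D"
    then obtain a b where ab: "a \<in> L" "b \<in> L" "C = Q `` {a}" "D = Q `` {b}"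
      by (auto elim!: quotientE)
    then have "(T a, T b) \<in> R"
      using eq \<Phi> T eq_equiv_class_iff[OF R, of "T a" "T b"] by auto
    then show "C = D"
      using ab Q equiv_class_eq[OF equivQ] by blast
  qed
  moreover have "\<Phi> ` (L // Q) = S // R"
    using \<Phi> T by (auto simp: quotient_def)
  ultimately show ?thesis
    using \<Phi> by (intro exI[of _ \<Phi>]) (auto simp: bij_betw_def)
qed

section \<open>Linear maps and Lie algebras on subspaces\<close>

context vector_space
begin

lemma linear_on_rules:
  assumes "linear_on scale S T f" "subspace S" "subspace T"
  shows "x \<in> S \<Longrightarrow> f x \<in> T"
    and "x \<in> S \<Longrightarrow> y \<in> S \<Longrightarrow> f (x + y) = f x + f y"
    and "x \<in> S \<Longrightarrow> y \<in> S \<Longrightarrow> f (x - y) = f x - f y"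
    and "x \<in> S \<Longrightarrow> f (scale c x) = scale c (f x)"
    and "f 0 = 0"
proof -
  have add: "f (x + y) = f x + f y" if "x \<in> S" "y \<in> S" for x y
    using assms(1) that by (simp add: linear_on_def)
  have scale: "f (scale c x) = scale c (f x)" if "x \<in> S" for x c
    using assms(1) that by (simp add: linear_on_def)
  show "x \<in> S \<Longrightarrow> f x \<in> T"
    using assms(1) by (auto simp: linear_on_def)
  show "x \<in> S \<Longrightarrow> y \<in> S \<Longrightarrow> f (x + y) = f x + f y"
    by (rule add)
  show "x \<in> S \<Longrightarrow> f (scale c x) = scale c (f x)"
    by (rule scale)
  show "f 0 = 0"
    using scale[of 0 0] subspace_0[OF assms(2)] by simp
  show "f (x - y) = f x - f y" if "x \<in> S" "y \<in> S"
    using add[of x "scale (-1) y"] scale[of y "-1"] subspace_neg[OF assms(2), of y] that by simp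
qed

lemma bilinear_on_rules:
  assumes "bilinear_on scale S T U b" "subspace S" "subspace T" "subspace U"
  shows "x \<in> S \<Longrightarrow> y \<in> T \<Longrightarrow> b x y \<in> U"
    and "x \<in> S \<Longrightarrow> x' \<in> S \<Longrightarrow> y \<in> T \<Longrightarrow> b (x + x') y = b x y + b x' y"
    and "x \<in> S \<Longrightarrow> y \<in> T \<Longrightarrow> y' \<in> T \<Longrightarrow> b x (y + y') = b x y + b x y'"
    and "x \<in> S \<Longrightarrow> y \<in> T \<Longrightarrow> b (scale c x) y = scale c (b x y)"
    and "x \<in> S \<Longrightarrow> y \<in> T \<Longrightarrow> b x (scale c y) = scale c (b x y)"
    and "x \<in> S \<Longrightarrow> b x 0 = 0"
    and "y \<in> T \<Longrightarrow> b 0 y = 0"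
proof -
  have left: "linear_on scale S U (\<lambda>x. b x y)" if "y \<in> T" for y
    using assms(1) that by (simp add: bilinear_on_def)
  have right: "linear_on scale T U (b x)" if "x \<in> S" for x
    using assms(1) that by (simp add: bilinear_on_def)
  show "x \<in> S \<Longrightarrow> y \<in> T \<Longrightarrow> b x y \<in> U"
    and "x \<in> S \<Longrightarrow> y \<in> T \<Longrightarrow> y' \<in> T \<Longrightarrow> b x (y + y') = b x y + b x y'"
    and "x \<in> S \<Longrightarrow> y \<in> T \<Longrightarrow> b x (scale c y) = scale c (b x y)"
    and "x \<in> S \<Longrightarrow> b x 0 = 0"
    using linear_on_rules[OF right assms(3,4)] by auto
  show "x \<in> S \<Longrightarrow> x' \<in> S \<Longrightarrow> y \<in> T \<Longrightarrow> b (x + x') y = b x y + b x' y"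
    and "x \<in> S \<Longrightarrow> y \<in> T \<Longrightarrow> b (scale c x) y = scale c (b x y)"
    and "y \<in> T \<Longrightarrow> b 0 y = 0"
    using linear_on_rules[OF left assms(2,4)] by auto
qed

lemma restrict2_bilinear:
  assumes S: "subspace S" and T: "subspace T"
    and mem: "\<And>x y. F x y \<in> U"
    and add: "\<And>x x' y. F (x + x') y = F x y + F x' y" "\<And>x y y'. F x (y + y') = F x y + F x y'"
    and scale: "\<And>c x y. F (scale c x) y = scale c (F x y)" "\<And>c x y. F x (scale c y) = scale c (F x y)"
  shows "(\<lambda>x\<in>S. \<lambda>y\<in>T. F x y) \<in> S \<rightarrow>\<^sub>E T \<rightarrow>\<^sub>E U"
    and "bilinear_on scale S T U (\<lambda>x\<in>S. \<lambda>y\<in>T. F x y)"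
proof -
  show "(\<lambda>x\<in>S. \<lambda>y\<in>T. F x y) \<in> S \<rightarrow>\<^sub>E T \<rightarrow>\<^sub>E U"
    using mem by (intro restrict_PiE_iff[THEN iffD2] ballI)
  show "bilinear_on scale S T U (\<lambda>x\<in>S. \<lambda>y\<in>T. F x y)"
    unfolding bilinear_on_def linear_on_def
    by (intro conjI ballI allI funcsetI)
      (simp_all add: mem add scale subspace_add[OF S] subspace_add[OF T]
        subspace_scale[OF S] subspace_scale[OF T])
qed

end

text \<open>
  Expanding \<open>[x + y, x + y] = 0\<close> gives this in every characteristic.
\<close>
lemma (in lie_algebra) antisymmetric:
  assumes "x \<in> L" "y \<in> L"
  shows "br y x = - br x y"
proof -
  note b = bilinear_on_rules[OF bilinear_br subspace_carrier subspace_carrier subspace_carrier]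
  have sum: "x + y \<in> L"
    using assms subspace_add[OF subspace_carrier] by blast
  have "br x y + br y x = (br x x + br x y) + (br y x + br y y)"
    using assms alternating by simp
  also have "\<dots> = br (x + y) (x + y)"
    using assms sum by (simp add: b algebra_simps)
  also have "\<dots> = 0"
    using sum by (rule alternating)
  finally show ?thesis by (simp add: eq_neg_iff_add_eq_0 add.commute)
qed

text \<open>
  Each axiom is an equation in \<open>L1\<close>; its image under the injective \<open>\<psi>\<close> is the same axiom in
  \<open>L2\<close>. Used along \<open>(g, x) \<mapsto> g + x\<close> and along its inverse.
\<close>
lemma lie_algebra_pullback:
  assumes lie: "lie_algebra s2 L2 b2" and vs: "vector_space s1" and sub: "module.subspace s1 L1"
    and lin: "Vector_Spaces.linear s1 s2 \<psi>" and inj: "inj_on \<psi> L1" and im: "\<psi> ` L1 \<subseteq> L2"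
    and closed: "\<And>a b. a \<in> L1 \<Longrightarrow> b \<in> L1 \<Longrightarrow> b1 a b \<in> L1"
    and hom: "\<And>a b. a \<in> L1 \<Longrightarrow> b \<in> L1 \<Longrightarrow> \<psi> (b1 a b) = b2 (\<psi> a) (\<psi> b)"
  shows "lie_algebra s1 L1 b1"
proof -
  interpret L1: vector_space s1 by (rule vs)
  interpret L2: lie_algebra s2 L2 b2 by (rule lie)
  interpret \<psi>: Vector_Spaces.linear s1 s2 \<psi> by (rule lin)
  note b2 = L2.bilinear_on_rules[OF L2.bilinear_br L2.subspace_carrier L2.subspace_carrier
      L2.subspace_carrier]
  note mem = closed L1.subspace_add[OF sub] L1.subspace_scale[OF sub] L1.subspace_0[OF sub]
  have img: "a \<in> L1 \<Longrightarrow> \<psi> a \<in> L2" for a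
    using im by blast
  have eqI: "a = b" if "\<psi> a = \<psi> b" "a \<in> L1" "b \<in> L1" for a b
    using inj that by (auto dest: inj_onD)
  note transfer = mem img hom b2 \<psi>.add \<psi>.scale \<psi>.zero
  show ?thesis
  proof
    show "L1.subspace L1" by (rule sub)
    show "bilinear_on s1 L1 L1 L1 b1"
      unfolding bilinear_on_def linear_on_def
      by (intro conjI ballI allI funcsetI mem; (rule eqI)?) (simp_all add: transfer)
    show "b1 a a = 0" if "a \<in> L1" for a
      using that by (intro eqI) (simp_all add: transfer L2.alternating)
    show "b1 a (b1 b c) + b1 b (b1 c a) + b1 c (b1 a b) = 0"
      if "a \<in> L1" "b \<in> L1" "c \<in> L1" for a b c
      using that by (intro eqI) (simp_all add: transfer L2.jacobi)
  qed
qed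

section \<open>Components with respect to a complement\<close>

locale complemented_lie_algebra = lie_algebra sc G br
  for sc :: "'k::field \<Rightarrow> 'e::ab_group_add \<Rightarrow> 'e" and G br +
  fixes V :: "'e set"
  assumes complement: "is_complement sc G V"
begin

lemma subspace_V: "subspace V"
  using complement by (simp add: is_complement_def)

lemmas G_mem = subspace_add[OF subspace_carrier] subspace_diff[OF subspace_carrier]
  subspace_neg[OF subspace_carrier] subspace_0[OF subspace_carrier]
  subspace_scale[OF subspace_carrier]
lemmas V_mem = subspace_add[OF subspace_V] subspace_diff[OF subspace_V]
  subspace_neg[OF subspace_V] subspace_0[OF subspace_V] subspace_scale[OF subspace_V]
lemmas br_rules = bilinear_on_rules[OF bilinear_br subspace_carrier subspace_carrier
    subspace_carrier]

lemma sum_eq_iff: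
  assumes "g \<in> G" "h \<in> G" "x \<in> V" "y \<in> V"
  shows "g + x = h + y \<longleftrightarrow> g = h \<and> x = y"
proof
  assume eq: "g + x = h + y"
  then have "g - h = y - x" by (simp add: algebra_simps)
  moreover have "g - h \<in> G" "y - x \<in> V" using assms G_mem V_mem by auto
  ultimately have "y - x \<in> V \<inter> G" by simp
  then have "y - x = 0" using complement by (simp only: is_complement_def) simp
  then show "g = h \<and> x = y" using eq by simp
qed simp

lemma bij_sum: "bij_betw (\<lambda>(g, x). g + x) (G \<times> V) UNIV"
  unfolding bij_betw_def
proof
  show "inj_on (\<lambda>(g, x). g + x) (G \<times> V)"
    by (auto simp: inj_on_def sum_eq_iff)
  have "a \<in> {g + x |g x. g \<in> G \<and> x \<in> V}" for a
    using complement by (simp add: is_complement_def)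
  then show "(\<lambda>(g, x). g + x) ` (G \<times> V) = UNIV"
    by (auto simp: image_def) blast
qed

definition components :: "'e \<Rightarrow> 'e \<times> 'e" where
  "components = inv_into (G \<times> V) (\<lambda>(g, x). g + x)"

abbreviation "pG a \<equiv> fst (components a)"
abbreviation "pV a \<equiv> snd (components a)"

lemma components_sum: "g \<in> G \<Longrightarrow> x \<in> V \<Longrightarrow> components (g + x) = (g, x)"
  using bij_betw_inv_into_left[OF bij_sum, of "(g, x)"] by (simp add: components_def)

lemma sum_cases:
  obtains g x where "a = g + x" "g \<in> G" "x \<in> V" "components a = (g, x)"
proof -
  have "a \<in> (\<lambda>(g, x). g + x) ` (G \<times> V)"
    using bij_sum by (simp add: bij_betw_def)
  then show ?thesis
    using components_sum that by auto
qed

lemma components_mem: "components a \<in> G \<times> V" "pG a \<in> G" "pV a \<in> V"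
  by (cases a rule: sum_cases; simp)+

lemma pG_plus_pV: "pG a + pV a = a"
  by (cases a rule: sum_cases) simp

lemma components_G: "g \<in> G \<Longrightarrow> components g = (g, 0)"
  using components_sum[of g 0] V_mem by simp

lemma components_V: "x \<in> V \<Longrightarrow> components x = (0, x)"
  using components_sum[of 0 x] G_mem by simp

lemma components_add: "components (a + b) = components a + components b"
proof (cases a rule: sum_cases; cases b rule: sum_cases)
  fix g x h y assume "a = g + x" "b = h + y" "g \<in> G" "x \<in> V" "h \<in> G" "y \<in> V"
    "components a = (g, x)" "components b = (h, y)"
  then show ?thesis
    using components_sum[of "g + h" "x + y"] G_mem V_mem by (simp add: algebra_simps)
qed

lemma components_scale: "components (sc c a) = (sc c (pG a), sc c (pV a))"
proof (cases a rule: sum_cases)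
  fix g x assume "a = g + x" "g \<in> G" "x \<in> V" "components a = (g, x)"
  then show ?thesis
    using components_sum[of "sc c g" "sc c x"] G_mem V_mem by (simp add: scale_right_distrib)
qed

section \<open>Lie extending structures as Lie structures on the ambient space\<close>

sublocale E2: vector_space_prod sc sc ..

lemma linear_sum: "Vector_Spaces.linear E2.scale sc (\<lambda>(g, x). g + x)"
  by unfold_locales (auto simp: E2.scale_def scale_right_distrib)

lemma linear_components: "Vector_Spaces.linear sc E2.scale components"
  by unfold_locales (auto simp: E2.scale_def components_add components_scale)

lemma bilinear_datum:
  assumes "\<Omega> \<in> extending_data sc G V"
  shows bilinear_ract: "bilinear_on sc V G V (ract \<Omega>)"
    and bilinear_lact: "bilinear_on sc V G G (lact \<Omega>)"
    and bilinear_cocycle: "bilinear_on sc V V G (cocycle \<Omega>)"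
    and bilinear_vbr: "bilinear_on sc V V V (vbr \<Omega>)"
  using assms by (auto simp: extending_data_def)

lemmas datum_bilinear =
  bilinear_on_rules[OF bilinear_ract subspace_V subspace_carrier subspace_V]
  bilinear_on_rules[OF bilinear_lact subspace_V subspace_carrier subspace_carrier]
  bilinear_on_rules[OF bilinear_cocycle subspace_V subspace_V subspace_carrier]
  bilinear_on_rules[OF bilinear_vbr subspace_V subspace_V subspace_V]

abbreviation "brE \<Omega> \<equiv> transported_br G br V \<Omega>"

lemma brE_sum:
  assumes "g \<in> G" "h \<in> G" "x \<in> V" "y \<in> V"
  shows "brE \<Omega> (g + x) (h + y) =
    (br g h + lact \<Omega> x h - lact \<Omega> y g + cocycle \<Omega> x y) +
    (vbr \<Omega> x y + ract \<Omega> x h - ract \<Omega> y g)"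
  using components_sum[of g x] components_sum[of h y] assms
  by (simp add: transported_br_def Let_def components_def)

lemma unified_br_mem:
  assumes "\<Omega> \<in> extending_data sc G V" "a \<in> G \<times> V" "b \<in> G \<times> V"
  shows "unified_br br \<Omega> a b \<in> G \<times> V"
  using assms
  by (cases a; cases b) (auto intro!: G_mem V_mem simp: br_rules datum_bilinear)

lemma brE_components:
  assumes "\<Omega> \<in> extending_data sc G V"
  shows "components (brE \<Omega> a b) = unified_br br \<Omega> (components a) (components b)"
  using unified_br_mem[OF assms components_mem(1) components_mem(1), of a b]
  by (cases "unified_br br \<Omega> (components a) (components b)")
    (auto simp: transported_br_def Let_def components_def[symmetric] components_sum)

lemma lie_algebra_brE_iff:
  assumes "\<Omega> \<in> extending_data sc G V"
  shows "lie_algebra sc UNIV (brE \<Omega>) \<longleftrightarrow> lie_algebra E2.scale (G \<times> V) (unified_br br \<Omega>)"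
proof
  assume "lie_algebra sc UNIV (brE \<Omega>)"
  then show "lie_algebra E2.scale (G \<times> V) (unified_br br \<Omega>)"
  proof (rule lie_algebra_pullback)
    show "vector_space E2.scale" ..
    show "E2.p.subspace (G \<times> V)"
      by (rule E2.subspace_Times[OF subspace_carrier subspace_V])
    show "Vector_Spaces.linear E2.scale sc (\<lambda>(g, x). g + x)" by (rule linear_sum)
    show "inj_on (\<lambda>(g, x). g + x) (G \<times> V)" using bij_sum by (simp add: bij_betw_def)
    show "unified_br br \<Omega> a b \<in> G \<times> V" if "a \<in> G \<times> V" "b \<in> G \<times> V" for a b
      using unified_br_mem[OF assms that] .
    show "(case unified_br br \<Omega> a b of (g, x) \<Rightarrow> g + x) =
        brE \<Omega> (case a of (g, x) \<Rightarrow> g + x) (case b of (g, x) \<Rightarrow> g + x)"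
      if "a \<in> G \<times> V" "b \<in> G \<times> V" for a b
      using that by (cases a; cases b) (simp add: brE_sum)
  qed simp
next
  assume "lie_algebra E2.scale (G \<times> V) (unified_br br \<Omega>)"
  then show "lie_algebra sc UNIV (brE \<Omega>)"
  proof (rule lie_algebra_pullback)
    show "vector_space sc" ..
    show "Vector_Spaces.linear sc E2.scale components" by (rule linear_components)
    show "inj_on components UNIV"
      by (metis injI pG_plus_pV)
    show "components (brE \<Omega> a b) = unified_br br \<Omega> (components a) (components b)" for a b
      by (rule brE_components[OF assms])
  qed (use components_mem in \<open>auto simp: image_subset_iff\<close>)
qed

lemma brE_lie_structure:
  assumes "\<Omega> \<in> lie_extending_structures sc G br V"
  shows "brE \<Omega> \<in> lie_structures sc G br"
proof -
  have \<Omega>: "\<Omega> \<in> extending_data sc G V" and "lie_algebra sc UNIV (brE \<Omega>)"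
    using assms lie_algebra_brE_iff by (auto simp: lie_extending_structures_def)
  moreover have "brE \<Omega> g h = br g h" if "g \<in> G" "h \<in> G" for g h
    using brE_sum[OF that, of 0 0 \<Omega>] that by (simp add: V_mem datum_bilinear[OF \<Omega>])
  ultimately show ?thesis by (simp add: lie_structures_def)
qed

text \<open>
  On Lie structures this is a right inverse of the transport \<open>brE\<close>; the restrictions make the maps
  extensional, as extending data are.
\<close>
definition datum_of :: "('e \<Rightarrow> 'e \<Rightarrow> 'e) \<Rightarrow> 'e extending_datum" where
  "datum_of B =
     \<lparr>ract = (\<lambda>x\<in>V. \<lambda>g\<in>G. pV (B x g)), lact = (\<lambda>x\<in>V. \<lambda>g\<in>G. pG (B x g)),
      cocycle = (\<lambda>x\<in>V. \<lambda>y\<in>V. pG (B x y)), vbr = (\<lambda>x\<in>V. \<lambda>y\<in>V. pV (B x y))\<rparr>"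

text \<open>
  The datum of \<open>B\<close> records \<open>B x g\<close> but not \<open>B g x\<close>; antisymmetry recovers the latter. The Lie
  axioms for the unified product then come for free, because its transported bracket is \<open>B\<close>.
\<close>
lemma datum_of_mem:
  assumes "B \<in> lie_structures sc G br"
  shows "datum_of B \<in> lie_extending_structures sc G br V" "brE (datum_of B) = B"
proof -
  interpret B: lie_algebra sc UNIV B
    using assms by (simp add: lie_structures_def)
  have ext: "B g h = br g h" if "g \<in> G" "h \<in> G" for g h
    using assms that by (simp add: lie_structures_def)
  note B_rules = bilinear_on_rules[OF B.bilinear_br subspace_UNIV subspace_UNIV subspace_UNIV]
  have data: "datum_of B \<in> extending_data sc G V"
    unfolding extending_data_def datum_of_def mem_Collect_eq extending_datum.select_convs
    by (intro conjI restrict2_bilinear subspace_carrier subspace_V)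
      (simp_all add: B_rules components_add components_scale components_mem)
  have "brE (datum_of B) a b = B a b" for a b
  proof (cases a rule: sum_cases; cases b rule: sum_cases)
    fix g x h y assume a: "a = g + x" "g \<in> G" "x \<in> V" and b: "b = h + y" "h \<in> G" "y \<in> V"
    have "brE (datum_of B) a b = B g h + (pG (B x h) + pV (B x h)) - (pG (B y g) + pV (B y g))
        + (pG (B x y) + pV (B x y))"
      using a b by (simp add: brE_sum datum_of_def ext algebra_simps)
    also have "\<dots> = B g h + B x h - B y g + B x y"
      by (simp only: pG_plus_pV)
    also have "\<dots> = B a b"
      using B.antisymmetric[of g y] by (simp add: a b B_rules algebra_simps)
    finally show ?thesis .
  qed
  then show brE: "brE (datum_of B) = B" by blast
  show "datum_of B \<in> lie_extending_structures sc G br V"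
    using data lie_algebra_brE_iff[OF data] B.lie_algebra_axioms
    by (simp add: lie_extending_structures_def brE)
qed

text \<open>
  The trivial structure is the datum of the direct product of \<open>\<gg>\<close> and the abelian Lie algebra \<open>V\<close>.
\<close>
lemma trivial_structure_mem: "trivial_structure G V \<in> lie_extending_structures sc G br V"
proof -
  define B where "B a b = br (pG a) (pG b)" for a b
  have "lie_algebra sc UNIV B"
  proof
    show "bilinear_on sc UNIV UNIV UNIV B"
      by (simp add: bilinear_on_def linear_on_def B_def br_rules components_add components_scale
          components_mem)
  qed (simp_all add: B_def components_G br_rules components_mem alternating jacobi)
  then have "B \<in> lie_structures sc G br"
    by (simp add: lie_structures_def B_def components_G)
  moreover have "datum_of B = trivial_structure G V"
    by (auto simp: datum_of_def trivial_structure_def B_def components_V components_G br_rules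
        G_mem intro!: restrict_ext)
  ultimately show ?thesis
    using datum_of_mem(1) by metis
qed

section \<open>Equivalent data and stabilizing isomorphisms\<close>

text \<open>
  These are the formulas defining \<open>\<equiv>\<close>, evaluated at \<open>v x\<close> and \<open>v y\<close> to eliminate \<open>v\<inverse>\<close>. In this form
  they can be compared directly with the brackets of elements of \<open>V\<close>.
\<close>
definition datum_morphism ::
  "'e extending_datum \<Rightarrow> 'e extending_datum \<Rightarrow> ('e \<Rightarrow> 'e) \<Rightarrow> ('e \<Rightarrow> 'e) \<Rightarrow> bool" where
  "datum_morphism \<Omega> \<Omega>' r v \<longleftrightarrow> (\<forall>g\<in>G. \<forall>x\<in>V. \<forall>y\<in>V.
     ract \<Omega>' (v x) g = v (ract \<Omega> x g) \<and>
     lact \<Omega>' (v x) g = r (ract \<Omega> x g) + lact \<Omega> x g + br g (r x) \<and>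
     cocycle \<Omega>' (v x) (v y) =
       cocycle \<Omega> x y + r (vbr \<Omega> x y) + br (r x) (r y)
       - r (ract \<Omega> x (r y)) - lact \<Omega> x (r y) + r (ract \<Omega> y (r x)) + lact \<Omega> y (r x) \<and>
     vbr \<Omega>' (v x) (v y) = v (vbr \<Omega> x y) - v (ract \<Omega> x (r y)) + v (ract \<Omega> y (r x)))"

lemma ext_equiv_iff:
  "(\<Omega>, \<Omega>') \<in> ext_equiv sc G br V \<longleftrightarrow>
     \<Omega> \<in> lie_extending_structures sc G br V \<and> \<Omega>' \<in> lie_extending_structures sc G br V \<and>
     (\<exists>r v. linear_on sc V G r \<and> linear_on sc V V v \<and> bij_betw v V V \<and>
       datum_morphism \<Omega> \<Omega>' r v)"
proof -
  have "(\<forall>g\<in>G. \<forall>x\<in>V. \<forall>y\<in>V. P g (inv_into V v x) (inv_into V v y) x y) \<longleftrightarrow>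
      (\<forall>g\<in>G. \<forall>x\<in>V. \<forall>y\<in>V. P g x y (v x) (v y))"
    if v: "bij_betw v V V" for v and P :: "'e \<Rightarrow> 'e \<Rightarrow> 'e \<Rightarrow> 'e \<Rightarrow> 'e \<Rightarrow> bool"
  proof -
    have *: "v x \<in> V" "inv_into V v x \<in> V" "inv_into V v (v x) = x" "v (inv_into V v x) = x"
      if "x \<in> V" for x
      using v that bij_betw_inv_into_left[OF v] bij_betw_inv_into_right[OF v]
        bij_betw_inv_into[OF v] by (auto dest: bij_betwE)
    show ?thesis by (metis *)
  qed
  note reparametrize = this
  show ?thesis
    unfolding ext_equiv_def mem_Collect_eq case_prod_conv datum_morphism_def Let_def
    by (intro conj_cong refl ex_cong1) (subst reparametrize, auto)
qed

text \<open>
  The map \<open>g + x \<mapsto> (g + r x) + v x\<close>, the general form of a linear endomorphism of \<open>E\<close> that fixes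
  \<open>\<gg>\<close> pointwise.
\<close>
definition stab_map :: "('e \<Rightarrow> 'e) \<Rightarrow> ('e \<Rightarrow> 'e) \<Rightarrow> 'e \<Rightarrow> 'e" where
  "stab_map r v a = (pG a + r (pV a)) + v (pV a)"

lemma stab_map_sum: "g \<in> G \<Longrightarrow> x \<in> V \<Longrightarrow> stab_map r v (g + x) = (g + r x) + v x"
  by (simp add: stab_map_def components_sum)

text \<open>
  Comparing the \<open>\<gg>\<close>- and \<open>V\<close>-components of both sides on \<open>g + x\<close> and \<open>h + y\<close> turns the homomorphism
  property into the equations \<open>?P\<close> and \<open>?Q\<close> of the proof. Their sides are bilinear in \<open>(g, x)\<close> and
  \<open>(h, y)\<close>, so three cases carry the content: on \<open>\<gg> \<times> \<gg>\<close> they are trivial, on \<open>V \<times> \<gg>\<close> (and, with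
  opposite signs, on \<open>\<gg> \<times> V\<close>) they are the formulas for \<open>\<triangleleft>'\<close> and \<open>\<triangleright>'\<close>, and on \<open>V \<times> V\<close> they become
  those for \<open>f'\<close> and \<open>{-,-}'\<close> once \<open>\<triangleleft>'\<close> and \<open>\<triangleright>'\<close> have been eliminated.
\<close>
lemma stab_map_hom_iff:
  assumes \<Omega>: "\<Omega> \<in> extending_data sc G V" and \<Omega>': "\<Omega>' \<in> extending_data sc G V"
    and r: "linear_on sc V G r" and v: "linear_on sc V V v"
  shows "(\<forall>a b. stab_map r v (brE \<Omega> a b) = brE \<Omega>' (stab_map r v a) (stab_map r v b)) \<longleftrightarrow>
    datum_morphism \<Omega> \<Omega>' r v"
    (is "?hom \<longleftrightarrow> _")
proof -
  note rules = linear_on_rules[OF r subspace_V subspace_carrier]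
    linear_on_rules[OF v subspace_V subspace_V] datum_bilinear[OF \<Omega>] datum_bilinear[OF \<Omega>']
    br_rules G_mem V_mem
  let ?P = "\<lambda>g h x y. br g h + lact \<Omega> x h - lact \<Omega> y g + cocycle \<Omega> x y
      + r (vbr \<Omega> x y + ract \<Omega> x h - ract \<Omega> y g)
    = br (g + r x) (h + r y) + lact \<Omega>' (v x) (h + r y) - lact \<Omega>' (v y) (g + r x)
      + cocycle \<Omega>' (v x) (v y)"
  let ?Q = "\<lambda>g h x y. v (vbr \<Omega> x y + ract \<Omega> x h - ract \<Omega> y g)
    = vbr \<Omega>' (v x) (v y) + ract \<Omega>' (v x) (h + r y) - ract \<Omega>' (v y) (g + r x)"
  have PQ: "stab_map r v (brE \<Omega> (g + x) (h + y))
      = brE \<Omega>' (stab_map r v (g + x)) (stab_map r v (h + y)) \<longleftrightarrow> ?P g h x y \<and> ?Q g h x y"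
    if "g \<in> G" "h \<in> G" "x \<in> V" "y \<in> V" for g h x y
    using that by (simp add: brE_sum stab_map_sum sum_eq_iff rules del: add_diff_eq)
  have "?hom \<longleftrightarrow> (\<forall>g\<in>G. \<forall>h\<in>G. \<forall>x\<in>V. \<forall>y\<in>V. ?P g h x y \<and> ?Q g h x y)"
    using PQ by (metis sum_cases)
  also have "\<dots> \<longleftrightarrow> datum_morphism \<Omega> \<Omega>' r v"
  proof
    assume all: "\<forall>g\<in>G. \<forall>h\<in>G. \<forall>x\<in>V. \<forall>y\<in>V. ?P g h x y \<and> ?Q g h x y"
    have ract: "ract \<Omega>' (v x) g = v (ract \<Omega> x g)"
      and lact: "lact \<Omega>' (v x) g = r (ract \<Omega> x g) + lact \<Omega> x g + br g (r x)"
      if "g \<in> G" "x \<in> V" for g x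
    proof -
      have "?P 0 g x 0 \<and> ?Q 0 g x 0"
        using all that G_mem V_mem by blast
      then show "ract \<Omega>' (v x) g = v (ract \<Omega> x g)"
        and "lact \<Omega>' (v x) g = r (ract \<Omega> x g) + lact \<Omega> x g + br g (r x)"
        using that antisymmetric[of g "r x"] by (auto simp: rules algebra_simps)
    qed
    show "datum_morphism \<Omega> \<Omega>' r v"
      unfolding datum_morphism_def
    proof (intro ballI conjI)
      fix g x y assume mem: "g \<in> G" "x \<in> V" "y \<in> V"
      have rr: "br (r y) (r x) = - br (r x) (r y)"
        using mem by (intro antisymmetric) (simp_all add: rules)
      have "?P 0 0 x y \<and> ?Q 0 0 x y"
        using all mem G_mem V_mem by blast
      then have "cocycle \<Omega> x y + r (vbr \<Omega> x y)
          = br (r x) (r y) + lact \<Omega>' (v x) (r y) - lact \<Omega>' (v y) (r x) + cocycle \<Omega>' (v x) (v y)"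
        and "v (vbr \<Omega> x y) = vbr \<Omega>' (v x) (v y) + ract \<Omega>' (v x) (r y) - ract \<Omega>' (v y) (r x)"
        using mem by (auto simp: rules)
      then show "cocycle \<Omega>' (v x) (v y) =
           cocycle \<Omega> x y + r (vbr \<Omega> x y) + br (r x) (r y)
           - r (ract \<Omega> x (r y)) - lact \<Omega> x (r y) + r (ract \<Omega> y (r x)) + lact \<Omega> y (r x)"
        and "vbr \<Omega>' (v x) (v y) = v (vbr \<Omega> x y) - v (ract \<Omega> x (r y)) + v (ract \<Omega> y (r x))"
        using mem by (simp_all add: ract lact rules rr algebra_simps)
    qed (use ract lact in auto)
  next
    assume "datum_morphism \<Omega> \<Omega>' r v"
    then have eqs: "g \<in> G \<Longrightarrow> x \<in> V \<Longrightarrow> ract \<Omega>' (v x) g = v (ract \<Omega> x g)"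
      "g \<in> G \<Longrightarrow> x \<in> V \<Longrightarrow> lact \<Omega>' (v x) g = r (ract \<Omega> x g) + lact \<Omega> x g + br g (r x)"
      "x \<in> V \<Longrightarrow> y \<in> V \<Longrightarrow> cocycle \<Omega>' (v x) (v y) =
         cocycle \<Omega> x y + r (vbr \<Omega> x y) + br (r x) (r y)
         - r (ract \<Omega> x (r y)) - lact \<Omega> x (r y) + r (ract \<Omega> y (r x)) + lact \<Omega> y (r x)"
      "x \<in> V \<Longrightarrow> y \<in> V \<Longrightarrow> vbr \<Omega>' (v x) (v y) =
         v (vbr \<Omega> x y) - v (ract \<Omega> x (r y)) + v (ract \<Omega> y (r x))" for g x y
      \<comment> \<open>\<open>0 \<in> \<gg>\<close> is the value of \<open>g\<close> at which the formulas that do not mention \<open>g\<close> are read off\<close>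
      unfolding datum_morphism_def using G_mem(4) by blast+
    show "\<forall>g\<in>G. \<forall>h\<in>G. \<forall>x\<in>V. \<forall>y\<in>V. ?P g h x y \<and> ?Q g h x y"
    proof (intro ballI)
      fix g h x y assume mem: "g \<in> G" "h \<in> G" "x \<in> V" "y \<in> V"
      have "br h (r x) = - br (r x) h" "br (r y) (r x) = - br (r x) (r y)"
        using mem by (intro antisymmetric; simp add: rules)+
      then show "?P g h x y \<and> ?Q g h x y"
        using mem by (simp add: eqs rules)
    qed
  qed
  finally show ?thesis .
qed

lemma linear_stab_map:
  assumes r: "linear_on sc V G r" and v: "linear_on sc V V v"
  shows "Vector_Spaces.linear sc sc (stab_map r v)"
proof -
  note rules = linear_on_rules[OF r subspace_V subspace_carrier]
    linear_on_rules[OF v subspace_V subspace_V]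
  show ?thesis
    by unfold_locales
      (simp_all add: stab_map_def components_add components_scale components_mem rules
        scale_right_distrib algebra_simps)
qed

lemma bij_stab_map:
  assumes r: "linear_on sc V G r" and v: "linear_on sc V V v" and bij: "bij_betw v V V"
  shows "bij (stab_map r v)"
proof (rule bijI)
  note rules = linear_on_rules(1)[OF r subspace_V subspace_carrier]
    linear_on_rules(1)[OF v subspace_V subspace_V] G_mem V_mem
  show "inj (stab_map r v)"
  proof (rule injI)
    fix a b assume eq: "stab_map r v a = stab_map r v b"
    then have *: "pG a + r (pV a) = pG b + r (pV b)" "v (pV a) = v (pV b)"
      by (auto simp: stab_map_def sum_eq_iff rules components_mem)
    then have "pV a = pV b"
      using bij components_mem(3) by (meson bij_betw_def inj_onD)
    moreover from this * have "pG a = pG b"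
      by simp
    ultimately show "a = b"
      by (metis pG_plus_pV)
  qed
  have "b \<in> range (stab_map r v)" for b
  proof (cases b rule: sum_cases)
    fix h y assume b: "b = h + y" "h \<in> G" "y \<in> V"
    have "y \<in> v ` V"
      using b bij by (simp add: bij_betw_def)
    then obtain x where x: "x \<in> V" "v x = y"
      by blast
    then have "stab_map r v ((h - r x) + x) = b"
      using b stab_map_sum[of "h - r x" x r v] by (simp add: rules)
    then show ?thesis by blast
  qed
  then show "surj (stab_map r v)" by blast
qed

text \<open>
  The maps are \<open>r = pG \<circ> \<phi>\<close> and \<open>v = pV \<circ> \<phi>\<close> on \<open>V\<close>. Bijectivity of \<open>v\<close> is that of the map induced
  by \<open>\<phi>\<close> on \<open>E / \<gg> \<cong> V\<close>: it is onto because \<open>\<phi>\<close> is, and one-to-one because \<open>\<phi> a \<in> \<gg>\<close> implies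
  \<open>\<phi> a = \<phi> (\<phi> a)\<close>, hence \<open>a = \<phi> a \<in> \<gg>\<close>.
\<close>
lemma stabilizing_map_eq_stab_map:
  assumes lin: "Vector_Spaces.linear sc sc \<phi>" and bij: "bij \<phi>" and fix_G: "\<forall>g\<in>G. \<phi> g = g"
  obtains r v where "linear_on sc V G r" "linear_on sc V V v" "bij_betw v V V" "\<phi> = stab_map r v"
proof
  interpret \<phi>: Vector_Spaces.linear sc sc \<phi> by (rule lin)
  let ?r = "\<lambda>x. pG (\<phi> x)" and ?v = "\<lambda>x. pV (\<phi> x)"
  show "linear_on sc V G ?r" and v: "linear_on sc V V ?v"
    by (auto simp: linear_on_def \<phi>.add \<phi>.scale components_add components_scale components_mem)
  show "\<phi> = stab_map ?r ?v"
  proof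
    fix a
    have "\<phi> a = \<phi> (pG a) + \<phi> (pV a)"
      by (metis \<phi>.add pG_plus_pV)
    then show "\<phi> a = stab_map ?r ?v a"
      using fix_G by (simp add: stab_map_def components_mem pG_plus_pV add.assoc)
  qed
  show "bij_betw ?v V V"
    unfolding bij_betw_def
  proof
    show "inj_on ?v V"
    proof (rule inj_onI)
      fix x y assume xy: "x \<in> V" "y \<in> V" and eq: "?v x = ?v y"
      have "\<phi> (x - y) = (?r x + ?v x) - (?r y + ?v y)"
        by (simp add: \<phi>.diff pG_plus_pV)
      then have "\<phi> (x - y) = ?r x - ?r y"
        using eq by simp
      moreover have rr: "?r x - ?r y \<in> G"
        by (intro G_mem components_mem)
      ultimately have "\<phi> (x - y) = \<phi> (?r x - ?r y)"
        using fix_G by simp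
      then have "x - y = ?r x - ?r y"
        using bij by (simp add: bij_def inj_eq)
      then have "x - y \<in> G"
        using rr by simp
      moreover have "x - y \<in> V"
        using xy by (intro V_mem)
      ultimately show "x = y"
        using components_G[of "x - y"] components_V[of "x - y"] by simp
    qed
    show "?v ` V = V"
    proof
      show "?v ` V \<subseteq> V" using components_mem by blast
      show "V \<subseteq> ?v ` V"
      proof
        fix y assume y: "y \<in> V"
        obtain a where a: "y = \<phi> a" using bij by (metis bij_pointE)
        have "\<phi> a = pG a + \<phi> (pV a)"
          using fix_G components_mem by (metis \<phi>.add pG_plus_pV)
        then have "pV y = ?v (pV a)"
          using a by (simp add: components_add components_G components_mem)
        then show "y \<in> ?v ` V"
          using y components_V components_mem by auto
      qed
    qed
  qed
qed

lemma ext_equiv_iff_stab_equiv: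
  "(\<Omega>, \<Omega>') \<in> ext_equiv sc G br V \<longleftrightarrow>
     \<Omega> \<in> lie_extending_structures sc G br V \<and> \<Omega>' \<in> lie_extending_structures sc G br V \<and>
     (brE \<Omega>, brE \<Omega>') \<in> stab_equiv sc G br"
proof (cases "\<Omega> \<in> lie_extending_structures sc G br V \<and> \<Omega>' \<in> lie_extending_structures sc G br V")
  case True
  then have data: "\<Omega> \<in> extending_data sc G V" "\<Omega>' \<in> extending_data sc G V"
    by (auto simp: lie_extending_structures_def)
  have "(\<exists>r v. linear_on sc V G r \<and> linear_on sc V V v \<and> bij_betw v V V \<and>
        datum_morphism \<Omega> \<Omega>' r v) \<longleftrightarrow>
      (\<exists>\<phi>. Vector_Spaces.linear sc sc \<phi> \<and> bij \<phi> \<and>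
        (\<forall>a b. \<phi> (brE \<Omega> a b) = brE \<Omega>' (\<phi> a) (\<phi> b)) \<and> (\<forall>g\<in>G. \<phi> g = g))"
    (is "?L \<longleftrightarrow> ?R")
  proof
    assume ?L
    then obtain r v where rv: "linear_on sc V G r" "linear_on sc V V v" "bij_betw v V V"
      "datum_morphism \<Omega> \<Omega>' r v" by blast
    moreover have "stab_map r v g = g" if "g \<in> G" for g
      using that linear_on_rules(5)[OF rv(1) subspace_V subspace_carrier]
        linear_on_rules(5)[OF rv(2) subspace_V subspace_V]
      by (simp add: stab_map_def components_G)
    ultimately show ?R
      using linear_stab_map bij_stab_map stab_map_hom_iff[OF data]
      by (intro exI[of _ "stab_map r v"]) blast
  next
    assume ?R
    then obtain \<phi> where \<phi>: "Vector_Spaces.linear sc sc \<phi>" "bij \<phi>" "\<forall>g\<in>G. \<phi> g = g"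
      and hom: "\<forall>a b. \<phi> (brE \<Omega> a b) = brE \<Omega>' (\<phi> a) (\<phi> b)" by blast
    obtain r v where rv: "linear_on sc V G r" "linear_on sc V V v" "bij_betw v V V"
      and eq: "\<phi> = stab_map r v"
      using stabilizing_map_eq_stab_map[OF \<phi>] by blast
    have "datum_morphism \<Omega> \<Omega>' r v"
      using hom stab_map_hom_iff[OF data rv(1,2)] by (simp add: eq)
    then show ?L using rv by blast
  qed
  then show ?thesis
    using True brE_lie_structure by (simp add: ext_equiv_iff stab_equiv_def)
qed (auto simp: ext_equiv_iff)

lemma equiv_stab_equiv: "equiv (lie_structures sc G br) (stab_equiv sc G br)"
proof (rule equivI)
  show "stab_equiv sc G br \<subseteq> lie_structures sc G br \<times> lie_structures sc G br"
    by (auto simp: stab_equiv_def)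
  show "refl_on (lie_structures sc G br) (stab_equiv sc G br)"
    by (auto simp: refl_on_def stab_equiv_def intro!: exI[of _ id] linear_id)
  show "sym (stab_equiv sc G br)"
  proof (rule symI)
    fix B B' assume "(B, B') \<in> stab_equiv sc G br"
    then obtain \<phi> where BB': "B \<in> lie_structures sc G br" "B' \<in> lie_structures sc G br"
      and lin: "Vector_Spaces.linear sc sc \<phi>" and bij: "bij \<phi>"
      and hom: "\<forall>a b. \<phi> (B a b) = B' (\<phi> a) (\<phi> b)" and fix_G: "\<forall>g\<in>G. \<phi> g = g"
      by (auto simp: stab_equiv_def)
    interpret \<phi>: Vector_Spaces.linear sc sc \<phi> by (rule lin)
    have inv: "inv \<phi> (\<phi> a) = a" "\<phi> (inv \<phi> a) = a" for a
      using bij by (auto simp: bij_def surj_f_inv_f)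
    have "Vector_Spaces.linear sc sc (inv \<phi>)"
      by unfold_locales (metis inv \<phi>.add \<phi>.scale)+
    moreover have "inv \<phi> (B' a b) = B (inv \<phi> a) (inv \<phi> b)" for a b
      by (metis inv hom)
    moreover have "inv \<phi> g = g" if "g \<in> G" for g
      using that fix_G by (metis inv(1))
    ultimately show "(B', B) \<in> stab_equiv sc G br"
      using BB' bij_imp_bij_inv[OF bij] by (auto simp: stab_equiv_def)
  qed
  show "trans (stab_equiv sc G br)"
  proof (rule transI)
    fix B1 B2 B3 assume "(B1, B2) \<in> stab_equiv sc G br" "(B2, B3) \<in> stab_equiv sc G br"
    then obtain \<phi> \<psi> where "B1 \<in> lie_structures sc G br" "B3 \<in> lie_structures sc G br"
      "Vector_Spaces.linear sc sc \<phi>" "bij \<phi>"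
      "\<forall>a b. \<phi> (B1 a b) = B2 (\<phi> a) (\<phi> b)" "\<forall>g\<in>G. \<phi> g = g"
      "Vector_Spaces.linear sc sc \<psi>" "bij \<psi>"
      "\<forall>a b. \<psi> (B2 a b) = B3 (\<psi> a) (\<psi> b)" "\<forall>g\<in>G. \<psi> g = g"
      by (auto simp: stab_equiv_def)
    then show "(B1, B3) \<in> stab_equiv sc G br"
      by (auto simp: stab_equiv_def bij_comp intro!: exI[of _ "\<psi> \<circ> \<phi>"]
          Vector_Spaces.linear_compose)
  qed
qed

end

section \<open>Classification of the extending structures\<close>

theorem theorem2p7:
  fixes sc :: "'k::field \<Rightarrow> 'e::ab_group_add \<Rightarrow> 'e"
    and G V :: "'e set"
    and br :: "'e \<Rightarrow> 'e \<Rightarrow> 'e"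
  assumes "vector_space sc"
    and "lie_algebra sc G br"
    and "G \<noteq> {0}"
    and "is_complement sc G V"
  shows "equiv (lie_extending_structures sc G br V) (ext_equiv sc G br V)
         \<and> trivial_structure G V \<in> lie_extending_structures sc G br V
         \<and> (\<exists>\<Phi>. (\<forall>\<Omega> \<in> lie_extending_structures sc G br V.
               \<Phi> (ext_equiv sc G br V `` {\<Omega>})
               = stab_equiv sc G br `` {transported_br G br V \<Omega>})
             \<and> bij_betw \<Phi> (H2 sc G br V) (Extd sc G br))"
proof -
  interpret complemented_lie_algebra sc G br V
    using assms(2,4) by (intro complemented_lie_algebra.intro complemented_lie_algebra_axioms.intro)
  have onto: "transported_br G br V ` lie_extending_structures sc G br V = lie_structures sc G br"
    using brE_lie_structure datum_of_mem(1) datum_of_mem(2)[symmetric] by (blast intro: image_eqI)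
  show ?thesis
    unfolding H2_def Extd_def
    using equiv_pullback[OF equiv_stab_equiv _ ext_equiv_iff_stab_equiv] onto
      trivial_structure_mem bij_betw_quotients[OF equiv_stab_equiv onto ext_equiv_iff_stab_equiv]
    by blast
qed

end
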